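(* Let $\bm H\in\mathbb F^{q\times K}$ be the Hankel matrix and $\bm\Phi=\bm U_p\bm Q\in\mathbb F^{q\times p}$, $\bm C=\bm\Phi^{\mathrm H}\bm H\in\mathbb F^{p\times K}$ the Hankel–Koopman energy-mode matrix and coefficient matrix defined in the context. Then the modes (columns of $\bm\Phi$) are orthonormal with respect to the inner product $\langle\bm x,\bm y\rangle:=\bm x^{\mathrm H}\bm y$, i.e. $$\bm\Phi^{\mathrm H}\bm\Phi=\bm I_p .$$ Consequently, $\bm C$ is the unique coefficient matrix of the (columnwise) orthogonal projection of $\bm H$ onto $\operatorname{Range}(\bm\Phi)$, and this projection is $$\widehat{\bm H}_p=\bm\Phi\bm C=\bm\Phi\bm\Phi^{\mathrm H}\bm H .$$
   Context: $\mathbb F=\mathbb R$ or $\mathbb C$; $(\cdot)^{\mathrm H}$ is the conjugate transpose. Let $\bm x_H=(x_{H,1},\ldots,x_{H,N_H})\in\mathbb F^{N_H}$ (the columnwise vectorization of a centered data matrix in $\mathbb F^{m\times N}$, $N_H=mN$), $q\in\{1,\ldots,N_H-1\}$, $K=N_H-q+1\ge2$. The Hankel matrix $\bm H\in\mathbb F^{q\times K}$ has entries $H_{ij}=x_{H,i+j-1}$ and columns $\bm h_1,\ldots,\bm h_K$; $\bm H_0=[\bm h_1\cdots\bm h_{K-1}]$, $\bm H_1=[\bm h_2\cdots\bm h_K]$. Let $p=\operatorname{rank}(\bm H_0)\ge1$ and let $\bm H_0=\bm U_p\bm\Sigma_p\bm V_p^{\mathrm H}$ be the economy-size SVD restricted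 to the positive singular values: $\bm U_p\in\mathbb F^{q\times p}$, $\bm V_p\in\mathbb F^{(K-1)\times p}$, $\bm U_p^{\mathrm H}\bm U_p=\bm V_p^{\mathrm H}\bm V_p=\bm I_p$, and $\bm\Sigma_p$ diagonal with positive diagonal. Define $\widetilde{\bm K}_p=\bm U_p^{\mathrm H}\bm H_1\bm V_p\bm\Sigma_p^{-1}\in\mathbb F^{p\times p}$ and $\bm G_p=\widetilde{\bm K}_p^{\mathrm H}\widetilde{\bm K}_p$ (self-adjoint, positive semidefinite). Let $\bm Q=[\bm q_1,\ldots,\bm q_p]\in\mathbb F^{p\times p}$ be a matrix of orthonormal eigenvectors of $\bm G_p$: $\bm G_p\bm Q=\bm Q\bm\Lambda_G$, $\bm\Lambda_G=\operatorname{diag}(\mu_1,\ldots,\mu_p)$, $\mu_1\ge\cdots\ge\mu_p\ge0$, $\bm Q^{\mathrm H}\bm Q=\bm I_p$. *)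

theory Defs
  imports
    "Jordan_Normal_Form.Schur_Decomposition"
    "Jordan_Normal_Form.DL_Rank"
    "Jordan_Normal_Form.Gauss_Jordan_Elimination"
begin

text \<open>
  The scalar field is \<open>\<real>\<close> or \<open>\<complex>\<close>. By the Gelfand--Mazur theorem every \<^class>\<open>real_normed_field\<close>
  is isometrically isomorphic to one of these two, and the axiom below then forces \<^const>\<open>conjugate\<close>
  to be the usual conjugation.
\<close>

class real_or_complex = real_normed_field + conjugatable_field +
  assumes conjugate_mult_self: "conjugate x * x = ((norm x)\<^sup>2) *\<^sub>R 1"

instance real :: real_or_complex
  by intro_classes (simp add: power2_eq_square)

instance complex :: real_or_complex
  by intro_classes (simp add: scaleR_conv_of_real complex_norm_square mult.commute del: of_real_power)

text \<open>All indices below start at \<open>0\<close>.\<close>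

definition columnwise_vec :: "'a mat \<Rightarrow> 'a vec" where
  "columnwise_vec X =
     vec (dim_row X * dim_col X) (\<lambda>k. X $$ (k mod dim_row X, k div dim_row X))"

definition hankel_mat :: "nat \<Rightarrow> 'a vec \<Rightarrow> 'a mat" where
  "hankel_mat q x = mat q (dim_vec x - q + 1) (\<lambda>(i, j). x $ (i + j))"

definition drop_last_col :: "'a mat \<Rightarrow> 'a mat" where
  "drop_last_col A = mat (dim_row A) (dim_col A - 1) (\<lambda>(i, j). A $$ (i, j))"

definition drop_first_col :: "'a mat \<Rightarrow> 'a mat" where
  "drop_first_col A = mat (dim_row A) (dim_col A - 1) (\<lambda>(i, j). A $$ (i, j + 1))"

definition is_positive_svd ::
    "'a::real_or_complex mat \<Rightarrow> nat \<Rightarrow> 'a mat \<Rightarrow> 'a mat \<Rightarrow> 'a mat \<Rightarrow> bool" where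
  "is_positive_svd A p U S V \<longleftrightarrow>
     U \<in> carrier_mat (dim_row A) p \<and> V \<in> carrier_mat (dim_col A) p \<and>
     mat_adjoint U * U = 1\<^sub>m p \<and> mat_adjoint V * V = 1\<^sub>m p \<and>
     (\<exists>\<sigma> :: nat \<Rightarrow> real. (\<forall>i<p. \<sigma> i > 0) \<and> S = mat_diag p (\<lambda>i. of_real (\<sigma> i))) \<and>
     A = U * S * mat_adjoint V"

text \<open>
  \<^const>\<open>mat_inverse\<close> is option-valued; it is only applied to the invertible diagonal factor \<open>S\<close>
  of \<^const>\<open>is_positive_svd\<close>.
\<close>

definition reduced_koopman ::
    "'a::real_or_complex mat \<Rightarrow> 'a mat \<Rightarrow> 'a mat \<Rightarrow> 'a mat \<Rightarrow> 'a mat" where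
  "reduced_koopman H1 U S V = mat_adjoint U * H1 * V * the (mat_inverse S)"

definition is_ordered_eigenbasis ::
    "'a::real_or_complex mat \<Rightarrow> nat \<Rightarrow> 'a mat \<Rightarrow> (nat \<Rightarrow> real) \<Rightarrow> bool" where
  "is_ordered_eigenbasis G p Q \<mu> \<longleftrightarrow>
     Q \<in> carrier_mat p p \<and> mat_adjoint Q * Q = 1\<^sub>m p \<and>
     G * Q = Q * mat_diag p (\<lambda>i. of_real (\<mu> i)) \<and>
     (\<forall>i<p. \<mu> i \<ge> 0) \<and> (\<forall>i j. i \<le> j \<and> j < p \<longrightarrow> \<mu> j \<le> \<mu> i)"

definition herm_inner :: "'a::real_or_complex vec \<Rightarrow> 'a vec \<Rightarrow> 'a" where
  "herm_inner x y = conjugate x \<bullet> y"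

definition mat_range :: "'a::real_or_complex mat \<Rightarrow> 'a vec set" where
  "mat_range A = (\<lambda>c. A *\<^sub>v c) ` carrier_vec (dim_col A)"

definition is_orth_proj :: "'a::real_or_complex vec set \<Rightarrow> 'a vec \<Rightarrow> 'a vec \<Rightarrow> bool" where
  "is_orth_proj W h y \<longleftrightarrow> y \<in> W \<and> (\<forall>w\<in>W. herm_inner w (h - y) = 0)"

definition is_columnwise_orth_proj ::
    "'a::real_or_complex vec set \<Rightarrow> 'a mat \<Rightarrow> 'a mat \<Rightarrow> bool" where
  "is_columnwise_orth_proj W A B \<longleftrightarrow>
     B \<in> carrier_mat (dim_row A) (dim_col A) \<and>
     (\<forall>j<dim_col A. is_orth_proj W (col A j) (col B j))"

end

theory Submission
  imports Defs
begin

text \<open>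
  With \<open>A\<^sup>H\<close> the adjoint, \<open>\<langle>A d, h - A c\<rangle> = \<langle>d, A\<^sup>H h - A\<^sup>H A c\<rangle>\<close>. If \<open>A\<^sup>H A = I\<close>, then \<open>h - A c\<close>
  is orthogonal to the range of \<open>A\<close> precisely when \<open>c = A\<^sup>H h\<close>. The theorem applies this
  columnwise to \<open>\<Phi> = U Q\<close>, whose columns are orthonormal because those of \<open>U\<close> and \<open>Q\<close> are.
\<close>

lemma dim_mat_adjoint [simp]:
  "dim_row (mat_adjoint A) = dim_col A" "dim_col (mat_adjoint A) = dim_row A"
  by (simp_all add: mat_adjoint_def)

lemma mat_adjoint_carrier [simp]:
  "A \<in> carrier_mat n m \<Longrightarrow> mat_adjoint A \<in> carrier_mat m n"
  by auto

lemma index_mat_adjoint [simp]: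
  "i < dim_col A \<Longrightarrow> j < dim_row A \<Longrightarrow> mat_adjoint A $$ (i, j) = conjugate (A $$ (j, i))"
  by (simp add: mat_adjoint_def mat_of_rows_def)

lemma row_mat_adjoint:
  "i < dim_col A \<Longrightarrow> row (mat_adjoint A) i = conjugate (col A i)"
  by (rule eq_vecI) auto

lemma mat_adjoint_mult:
  fixes A B :: "'a::conjugatable_field mat"
  assumes "A \<in> carrier_mat n k" and "B \<in> carrier_mat k m"
  shows "mat_adjoint (A * B) = mat_adjoint B * mat_adjoint A"
proof (rule eq_matI)
  fix i j
  assume "i < dim_row (mat_adjoint B * mat_adjoint A)"
    and "j < dim_col (mat_adjoint B * mat_adjoint A)"
  then show "mat_adjoint (A * B) $$ (i, j) = (mat_adjoint B * mat_adjoint A) $$ (i, j)"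
    using assms
    by (auto simp: scalar_prod_def sum_conjugate conjugate_dist_mul mult.commute intro!: sum.cong)
qed auto

text \<open>The transpose of the adjoint is the entrywise conjugate of \<open>A\<close>; this form
  lets the bilinear transpose rule move the matrix across a scalar product.\<close>

lemma conjugate_mult_mat_vec:
  fixes A :: "'a::conjugatable_field mat"
  assumes "A \<in> carrier_mat n k" and "d \<in> carrier_vec k"
  shows "conjugate (A *\<^sub>v d) = transpose_mat (mat_adjoint A) *\<^sub>v conjugate d"
  using assms
  by (intro eq_vecI)
    (auto simp: scalar_prod_def sum_conjugate conjugate_dist_mul intro!: sum.cong)

text \<open>Turns orthogonality to the range of \<open>A\<close> into a condition on coefficient
  vectors.\<close>

lemma herm_inner_mult_mat_vec:
  assumes "A \<in> carrier_mat n k" and "d \<in> carrier_vec k" and "v \<in> carrier_vec n"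
  shows "herm_inner (A *\<^sub>v d) v = herm_inner d (mat_adjoint A *\<^sub>v v)"
  using assms
  by (simp add: herm_inner_def conjugate_mult_mat_vec[OF assms(1,2)]
      transpose_vec_mult_scalar[of _ k n])

lemma herm_inner_eq_zero_all_iff:
  assumes "v \<in> carrier_vec k"
  shows "(\<forall>d\<in>carrier_vec k. herm_inner d v = 0) \<longleftrightarrow> v = 0\<^sub>v k"
proof
  assume *: "\<forall>d\<in>carrier_vec k. herm_inner d v = 0"
  show "v = 0\<^sub>v k"
  proof (rule eq_vecI)
    fix i assume "i < dim_vec (0\<^sub>v k)"
    then have i: "i < k" by simp
    \<comment> \<open>The two conjugations cancel, so this product is the plain entry
      \<open>v $ i\<close>.\<close>
    have "herm_inner (conjugate (unit_vec k i)) v = 0"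
      using * by simp
    then show "v $ i = 0\<^sub>v k $ i"
      using assms i by (simp add: herm_inner_def)
  qed (use assms in simp)
qed (auto simp: herm_inner_def)

lemma is_orth_proj_isometry_iff:
  assumes A: "A \<in> carrier_mat n k" and iso: "mat_adjoint A * A = 1\<^sub>m k"
    and h: "h \<in> carrier_vec n" and c: "c \<in> carrier_vec k"
  shows "is_orth_proj (mat_range A) h (A *\<^sub>v c) \<longleftrightarrow> c = mat_adjoint A *\<^sub>v h"
proof -
  have A': "mat_adjoint A \<in> carrier_mat k n" using A by simp
  have Ac: "A *\<^sub>v c \<in> carrier_vec n" using A c by simp
  have A'h: "mat_adjoint A *\<^sub>v h \<in> carrier_vec k" using A' h by simp
  \<comment> \<open>Orthonormality of the columns enters here: the adjoint recovers the coefficients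
    from \<open>A\<close> applied to them.\<close>
  have "mat_adjoint A *\<^sub>v (A *\<^sub>v c) = c"
    using assoc_mult_mat_vec[OF A' A c] iso c by simp
  then have residual: "mat_adjoint A *\<^sub>v (h - A *\<^sub>v c) = mat_adjoint A *\<^sub>v h - c"
    using mult_minus_distrib_mat_vec[OF A' h Ac] by simp
  \<comment> \<open>Membership in the range is automatic for \<open>A\<close> applied to
    \<open>c\<close>, so only the orthogonality of the residual remains.\<close>
  have "is_orth_proj (mat_range A) h (A *\<^sub>v c) \<longleftrightarrow>
      (\<forall>d\<in>carrier_vec k. herm_inner (A *\<^sub>v d) (h - A *\<^sub>v c) = 0)"
    using A c by (auto simp: is_orth_proj_def mat_range_def)
  also have "\<dots> \<longleftrightarrow> (\<forall>d\<in>carrier_vec k. herm_inner d (mat_adjoint A *\<^sub>v h - c) = 0)"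
    using herm_inner_mult_mat_vec[OF A] h Ac by (simp add: residual)
  also have "\<dots> \<longleftrightarrow> mat_adjoint A *\<^sub>v h - c = 0\<^sub>v k"
    using A'h c by (intro herm_inner_eq_zero_all_iff) simp
  also have "\<dots> \<longleftrightarrow> c = mat_adjoint A *\<^sub>v h"
    using A'h c by (auto simp: vec_eq_iff simp del: index_mult_mat_vec dim_mult_mat_vec)
  finally show ?thesis .
qed

text \<open>Column \<open>j\<close> of \<open>A * C\<close> is \<open>A\<close> applied to column
  \<open>j\<close> of \<open>C\<close>, so the vector case fixes each column of \<open>C\<close>,
  and the columns determine the matrix.\<close>

lemma is_columnwise_orth_proj_coeff_iff:
  assumes A: "A \<in> carrier_mat n k" and iso: "mat_adjoint A * A = 1\<^sub>m k"
    and H: "H \<in> carrier_mat n l" and C: "C \<in> carrier_mat k l"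
  shows "is_columnwise_orth_proj (mat_range A) H (A * C) \<longleftrightarrow> C = mat_adjoint A * H"
proof -
  have "is_columnwise_orth_proj (mat_range A) H (A * C) \<longleftrightarrow>
      (\<forall>j<l. is_orth_proj (mat_range A) (col H j) (A *\<^sub>v col C j))"
    using A H C col_mult2[OF A C] by (auto simp: is_columnwise_orth_proj_def simp del: col_mult)
  also have "\<dots> \<longleftrightarrow> (\<forall>j<l. col C j = mat_adjoint A *\<^sub>v col H j)"
    using is_orth_proj_isometry_iff[OF A iso] H C by simp
  also have "\<dots> \<longleftrightarrow> (\<forall>j<l. col C j = col (mat_adjoint A * H) j)"
    using col_mult2[OF mat_adjoint_carrier[OF A] H] by simp
  also have "\<dots> \<longleftrightarrow> C = mat_adjoint A * H"
    using A H C by (auto intro!: mat_col_eqI)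
  finally show ?thesis .
qed

text \<open>Uniqueness among all matrices \<open>B\<close>, not only those given as products: each
  column of a projection lies in the range, so \<open>B\<close> factors through \<open>A\<close> and
  the coefficient criterion applies.\<close>

lemma is_columnwise_orth_proj_iff:
  assumes A: "A \<in> carrier_mat n k" and iso: "mat_adjoint A * A = 1\<^sub>m k"
    and H: "H \<in> carrier_mat n l"
  shows "is_columnwise_orth_proj (mat_range A) H B \<longleftrightarrow> B = A * (mat_adjoint A * H)"
proof
  assume B: "is_columnwise_orth_proj (mat_range A) H B"
  have dimB: "B \<in> carrier_mat n l"
    using B H by (auto simp: is_columnwise_orth_proj_def)
  have "\<exists>c. c \<in> carrier_vec k \<and> col B j = A *\<^sub>v c" if "j < l" for j
    using B H A that
    by (auto simp: is_columnwise_orth_proj_def is_orth_proj_def mat_range_def)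
  then obtain c where c: "\<And>j. j < l \<Longrightarrow> c j \<in> carrier_vec k \<and> col B j = A *\<^sub>v c j"
    by metis
  \<comment> \<open>The coefficient vectors chosen column by column become the columns of one
    matrix.\<close>
  define C where "C = mat_of_cols k (map c [0..<l])"
  have C: "C \<in> carrier_mat k l" by (auto simp: C_def)
  have "B = A * C"
  proof (rule mat_col_eqI)
    fix j assume "j < dim_col (A * C)"
    then have j: "j < l" using C by simp
    then have "col C j = c j" using c by (simp add: C_def)
    then show "col B j = col (A * C) j" using c[OF j] col_mult2[OF A C j] by simp
  qed (use dimB A C in auto)
  then show "B = A * (mat_adjoint A * H)"
    using B is_columnwise_orth_proj_coeff_iff[OF A iso H C] by simp
next
  assume "B = A * (mat_adjoint A * H)"
  then show "is_columnwise_orth_proj (mat_range A) H B"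
    using is_columnwise_orth_proj_coeff_iff[OF A iso H
        mult_carrier_mat[OF mat_adjoint_carrier[OF A] H]] by simp
qed

theorem proposition3:
  fixes X H H0 H1 U S V Kt G Q Phi C :: "'a::real_or_complex mat"
    and x :: "'a vec"
    and m N q K p :: nat
    and \<mu> :: "nat \<Rightarrow> real"
  assumes "X \<in> carrier_mat m N"
    and "x = columnwise_vec X"
    and "1 \<le> q" and "q \<le> m * N - 1"
    and "K = m * N - q + 1"
    and "H = hankel_mat q x"
    and "H0 = drop_last_col H" and "H1 = drop_first_col H"
    and "p = vec_space.rank q H0" and "p \<ge> 1"
    and "is_positive_svd H0 p U S V"
    and "Kt = reduced_koopman H1 U S V"
    and "G = mat_adjoint Kt * Kt"
    and "is_ordered_eigenbasis G p Q \<mu>"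
    and "Phi = U * Q"
    and "C = mat_adjoint Phi * H"
  shows "mat_adjoint Phi * Phi = 1\<^sub>m p \<and>
    (\<forall>i<p. \<forall>j<p. herm_inner (col Phi i) (col Phi j) = (if i = j then 1 else 0)) \<and>
    C \<in> carrier_mat p K \<and>
    (\<forall>C'\<in>carrier_mat p K. is_columnwise_orth_proj (mat_range Phi) H (Phi * C') \<longleftrightarrow> C' = C) \<and>
    (\<forall>Hhat. is_columnwise_orth_proj (mat_range Phi) H Hhat \<longleftrightarrow> Hhat = Phi * C) \<and>
    Phi * C = Phi * mat_adjoint Phi * H"
proof -
  \<comment> \<open>The vectorization has length \<open>m * N\<close>, which makes \<open>K\<close>
    the column count of the Hankel matrix.\<close>
  have H: "H \<in> carrier_mat q K"
    using assms(1,2,5,6) by (auto simp: hankel_mat_def columnwise_vec_def)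
  have U: "U \<in> carrier_mat q p" "mat_adjoint U * U = 1\<^sub>m p"
    using assms(7,11) H by (auto simp: is_positive_svd_def drop_last_col_def)
  have Q: "Q \<in> carrier_mat p p" "mat_adjoint Q * Q = 1\<^sub>m p"
    using assms(14) by (auto simp: is_ordered_eigenbasis_def)
  have Phi: "Phi \<in> carrier_mat q p"
    using assms(15) U Q by simp
  \<comment> \<open>Bracketed so that the adjoint of \<open>U\<close> meets \<open>U\<close> and
    cancels first, leaving the Gram matrix of \<open>Q\<close>.\<close>
  have "mat_adjoint Phi * Phi = mat_adjoint Q * (mat_adjoint U * (U * Q))"
    using U Q by (simp add: assms(15) mat_adjoint_mult[OF U(1) Q(1)]
        assoc_mult_mat[of _ p p _ q _ p])
  also have "mat_adjoint U * (U * Q) = Q"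
    using U Q by (simp flip: assoc_mult_mat[of _ p q _ p _ p])
  finally have iso: "mat_adjoint Phi * Phi = 1\<^sub>m p"
    using Q by simp
  have orthonormal: "herm_inner (col Phi i) (col Phi j) = (if i = j then 1 else 0)"
    if "i < p" "j < p" for i j
  proof -
    \<comment> \<open>Row \<open>i\<close> of the adjoint is the conjugated column \<open>i\<close>,
      so the inner products of the modes are the entries of the Gram matrix.\<close>
    have "herm_inner (col Phi i) (col Phi j) = (mat_adjoint Phi * Phi) $$ (i, j)"
      using that Phi by (simp add: herm_inner_def row_mat_adjoint)
    then show ?thesis using that by (simp add: iso)
  qed
  have C: "C \<in> carrier_mat p K"
    using assms(16) Phi H by auto
  have "Phi * C = Phi * mat_adjoint Phi * H"
    using assoc_mult_mat[OF Phi mat_adjoint_carrier[OF Phi] H] by (simp add: assms(16))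
  then show ?thesis
    using iso orthonormal C is_columnwise_orth_proj_coeff_iff[OF Phi iso H, folded assms(16)]
      is_columnwise_orth_proj_iff[OF Phi iso H, folded assms(16)] by blast
qed

end
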